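(* Let $X \subseteq \mathcal A^{\mathbb Z}$ be a minimal subshift such that there exists $\mu\in\mathcal M(X,S)$ for which the vector $(\mu([a]))_{a\in\mathcal A}$ has $\mathbb Q$-linearly independent coordinates. Then every letter-coboundary in $X$ is trivial.
   Context: A subshift is a closed set $X\subseteq\mathcal A^{\mathbb Z}$ ($\mathcal A$ a finite alphabet) with $S(X)=X$, $S$ the shift map; it is minimal if every orbit is dense. $\mathcal L(X)$ is the set of finite words occurring in points of $X$. $\mathcal M(X,S)$ is the set of $S$-invariant Borel probability measures on $X$, and $[a]=\{x\in X:x_0=a\}$. A return word to a letter $a$ in $X$ is a word $w\in\mathcal A^*$ such that $wa\in\mathcal L(X)$ and $wa$ contains exactly two occurrences of $a$, one as a prefix and one as a suffix. A letter-coboundary in $X$ is a monoid morphism $c:\mathcal A^*\to(\mathbb R,+)$ such that $c(w)=0$ for every letter $a$ and every return word $w$ to $a$ in $X$; it is trivial if $c(a)=0$ for all $a\in\mathcal A$. *)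

theory Defs
  imports "HOL-Probability.Probability" "HOL-Library.Sublist"
begin

type_synonym 'a biseq = "int \<Rightarrow> 'a"

definition full_shift :: "'a set \<Rightarrow> 'a biseq topology" where
  "full_shift A = product_topology (\<lambda>_. discrete_topology A) UNIV"

definition shift :: "'a biseq \<Rightarrow> 'a biseq" where
  "shift x = (\<lambda>i. x (i + 1))"

definition subshift :: "'a set \<Rightarrow> 'a biseq set \<Rightarrow> bool" where
  "subshift A X \<longleftrightarrow> closedin (full_shift A) X \<and> shift ` X = X"

text \<open>The two-sided orbit: the \<open>n\<close>-th iterate of the shift, \<open>n\<close> any integer,
  sends \<open>x\<close> to \<open>\<lambda>i. x (i + n)\<close>.\<close>

definition orbit :: "'a biseq \<Rightarrow> 'a biseq set" where
  "orbit x = range (\<lambda>n::int. \<lambda>i. x (i + n))"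

definition minimal_subshift :: "'a set \<Rightarrow> 'a biseq set \<Rightarrow> bool" where
  "minimal_subshift A X \<longleftrightarrow>
     subshift A X \<and> (\<forall>x\<in>X. subtopology (full_shift A) X closure_of orbit x = X)"

definition language :: "'a biseq set \<Rightarrow> 'a list set" where
  "language X = {w. \<exists>x\<in>X. \<exists>i::int. \<forall>k<length w. w ! k = x (i + int k)}"

definition borel_on :: "'b topology \<Rightarrow> 'b measure" where
  "borel_on T = sigma (topspace T) {U. openin T U}"

definition invariant_measures :: "'a set \<Rightarrow> 'a biseq set \<Rightarrow> 'a biseq measure set" where
  "invariant_measures A X =
     {M. prob_space M \<and> space M = X \<and>
         sets M = sets (borel_on (subtopology (full_shift A) X)) \<and>
         (\<forall>B\<in>sets M. measure M (shift -` B \<inter> X) = measure M B)}"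

definition cylinder :: "'a biseq set \<Rightarrow> 'a \<Rightarrow> 'a biseq set" where
  "cylinder X a = {x \<in> X. x 0 = a}"

text \<open>Linear independence over the rationals of a finite family (not of its set of values:
  two equal members make the family dependent).\<close>

definition rat_independent_family :: "'i set \<Rightarrow> ('i \<Rightarrow> real) \<Rightarrow> bool" where
  "rat_independent_family I v \<longleftrightarrow>
     (\<forall>q :: 'i \<Rightarrow> rat. (\<Sum>i\<in>I. of_rat (q i) * v i) = 0 \<longrightarrow> (\<forall>i\<in>I. q i = 0))"

interpretation rat_real: vector_space "\<lambda>(q::rat) (x::real). of_rat q * x"
  by unfold_locales (simp_all add: algebra_simps of_rat_add of_rat_mult)

lemma rat_independent_family_iff:
  assumes "finite I"
  shows "rat_independent_family I v \<longleftrightarrow> inj_on v I \<and> rat_real.independent (v ` I)"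
proof
  assume v: "rat_independent_family I v"
  have inj: "inj_on v I"
  proof (rule inj_onI, rule ccontr)
    fix i j assume ij: "i \<in> I" "j \<in> I" "v i = v j" "i \<noteq> j"
    define q :: "_ \<Rightarrow> rat" where "q = (\<lambda>k. (if k = i then 1 else 0) - (if k = j then 1 else 0))"
    have "(\<Sum>k\<in>I. of_rat (q k) * v k)
        = (\<Sum>k\<in>I. (if k = i then v k else 0) - (if k = j then v k else 0))"
      by (rule sum.cong) (auto simp: q_def)
    also have "\<dots> = 0" using ij assms by (simp add: sum_subtractf)
    finally have "q i = 0" using v ij unfolding rat_independent_family_def by blast
    then show False using ij by (simp add: q_def)
  qed
  moreover have "rat_real.independent (v ` I)"
  proof (rule rat_real.independent_if_scalars_zero)
    fix f x assume 0: "(\<Sum>x\<in>v ` I. of_rat (f x) * x) = 0" and x: "x \<in> v ` I"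
    have "(\<Sum>i\<in>I. of_rat (f (v i)) * v i) = 0" using 0 by (simp add: sum.reindex[OF inj])
    with v have "\<forall>i\<in>I. f (v i) = 0"
      unfolding rat_independent_family_def by (auto dest!: spec[of _ "\<lambda>i. f (v i)"])
    then show "f x = 0" using x by auto
  qed (use assms in simp)
  ultimately show "inj_on v I \<and> rat_real.independent (v ` I)" ..
next
  assume *: "inj_on v I \<and> rat_real.independent (v ` I)"
  show "rat_independent_family I v"
    unfolding rat_independent_family_def
  proof (intro allI impI ballI)
    fix q i assume 0: "(\<Sum>i\<in>I. of_rat (q i) * v i) = 0" and i: "i \<in> I"
    let ?f = "\<lambda>x. q (the_inv_into I v x)"
    have "(\<Sum>x\<in>v ` I. of_rat (?f x) * x) = (\<Sum>i\<in>I. of_rat (q i) * v i)"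
      using * by (subst sum.reindex) (auto simp: the_inv_into_f_f intro!: sum.cong)
    with 0 have "?f (v i) = 0"
      using rat_real.independentD[of "v ` I" "v ` I" ?f "v i"] * assms i by auto
    then show "q i = 0" using * i by (simp add: the_inv_into_f_f)
  qed
qed

definition return_word :: "'a set \<Rightarrow> 'a biseq set \<Rightarrow> 'a \<Rightarrow> 'a list \<Rightarrow> bool" where
  "return_word A X a w \<longleftrightarrow>
     w \<in> lists A \<and> w @ [a] \<in> language X \<and> count_list (w @ [a]) a = 2 \<and>
     prefix [a] (w @ [a]) \<and> suffix [a] (w @ [a])"

definition word_morphism :: "'a set \<Rightarrow> ('a list \<Rightarrow> real) \<Rightarrow> bool" where
  "word_morphism A c \<longleftrightarrow>
     c [] = 0 \<and> (\<forall>u\<in>lists A. \<forall>v\<in>lists A. c (u @ v) = c u + c v)"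

definition letter_coboundary :: "'a set \<Rightarrow> 'a biseq set \<Rightarrow> ('a list \<Rightarrow> real) \<Rightarrow> bool" where
  "letter_coboundary A X c \<longleftrightarrow>
     word_morphism A c \<and> (\<forall>a\<in>A. \<forall>w. return_word A X a w \<longrightarrow> c w = 0)"

definition trivial_coboundary :: "'a set \<Rightarrow> ('a list \<Rightarrow> real) \<Rightarrow> bool" where
  "trivial_coboundary A c \<longleftrightarrow> (\<forall>a\<in>A. c [a] = 0)"

end

theory Submission
  imports Defs
begin

text \<open>
  Along a point \<open>x\<close> of \<open>X\<close>, let \<open>S n\<close> be the signed sum of the weights \<open>c [x k]\<close> over the positions
  \<open>k\<close> between \<open>0\<close> and \<open>n\<close>.  A stretch of \<open>x\<close> between two occurrences of a letter \<open>a\<close> is a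
  concatenation of return words to \<open>a\<close>, so its weight is \<open>0\<close>; hence \<open>S n\<close> depends on the letter
  \<open>x n\<close> only, and there is a function \<open>g\<close> on letters with \<open>c [x n] = g (x (n + 1)) - g (x n)\<close> for
  all \<open>n\<close> (\<open>letter_coboundary_potential_along_point\<close>).  In a minimal subshift every two-letter word
  occurs in \<open>x\<close>, so this equation holds at all points of \<open>X\<close>: the function \<open>y \<mapsto> c [y 0]\<close> is the
  coboundary of \<open>y \<mapsto> g (y 0)\<close> (\<open>letter_coboundary_potential\<close>).

  A coboundary integrates to \<open>0\<close> against an invariant measure
  (\<open>invariant_measure_coboundary_sum_eq_0\<close>).  For \<open>c\<close> itself this is a linear relation
  with \<^emph>\<open>real\<close> coefficients between the numbers \<open>\<mu>([a])\<close>, which does not contradict independence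
  over the rationals.  However, applying an additive map \<open>\<phi>\<close> from the reals to the rationals to
  \<open>c\<close> and \<open>g\<close> preserves the coboundary equation.  The relation obtained in this way has the
  rational coefficients \<open>\<phi> (c [a])\<close>, which are therefore all \<open>0\<close>.  As additive maps into the
  rationals separate \<open>0\<close> from every other real (\<open>ex_additive_real_to_rat\<close>), \<open>c [a] = 0\<close>.
\<close>

section \<open>Letter-coboundaries are differences of a potential\<close>

lemma word_morphism_eq_sum_letters:
  assumes c: "word_morphism A c" and y: "\<And>k. y k \<in> A"
  shows "c (map y [0..<n]) = (\<Sum>k<n. c [y k])"
proof (induction n)
  case 0
  then show ?case using c by (simp add: word_morphism_def)
next
  case (Suc n)
  have "map y [0..<n] \<in> lists A" "[y n] \<in> lists A" using y by auto
  then have "c (map y [0..<n] @ [y n]) = c (map y [0..<n]) + c [y n]"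
    using c unfolding word_morphism_def by blast
  then show ?case using Suc by simp
qed

lemma return_word_first_return:
  fixes x :: "'a biseq"
  assumes x: "x \<in> X" "range x \<subseteq> A" and n: "0 < n" and ret: "x (i + int n) = x i"
    and first: "\<And>k. 0 < k \<Longrightarrow> k < n \<Longrightarrow> x (i + int k) \<noteq> x i"
  shows "return_word A X (x i) (map (\<lambda>k. x (i + int k)) [0..<n])"
proof -
  let ?y = "\<lambda>k. x (i + int k)"
  have app: "map ?y [0..<n] @ [x i] = map ?y [0..<Suc n]" using ret by simp
  have split: "map ?y [0..<n] = x i # map ?y [Suc 0..<n]"
    using n by (simp add: upt_conv_Cons)
  have "x i \<notin> set (map ?y [Suc 0..<n])"
  proof
    assume "x i \<in> set (map ?y [Suc 0..<n])"
    then obtain k where "Suc 0 \<le> k" "k < n" "?y k = x i" by auto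
    then show False using first[of k] by simp
  qed
  then have "count_list (map ?y [Suc 0..<n]) (x i) = 0" by (rule count_list_0_iff[THEN iffD2])
  then have cnt: "count_list (map ?y [0..<n] @ [x i]) (x i) = 2"
    by (simp add: split)
  have "\<forall>k<length (map ?y [0..<Suc n]). map ?y [0..<Suc n] ! k = x (i + int k)"
    by (simp del: upt_Suc)
  then have "map ?y [0..<n] @ [x i] \<in> language X"
    unfolding language_def app using x(1) by blast
  moreover have "map ?y [0..<n] \<in> lists A" using x(2) by (auto simp: image_subset_iff)
  moreover have "prefix [x i] (map ?y [0..<n] @ [x i])" by (simp add: split)
  ultimately show ?thesis using cnt by (simp add: return_word_def)
qed

text \<open>Cut the stretch at its successive visits to the letter \<open>x i\<close>: the pieces are return words.\<close>

lemma letter_coboundary_sum_between_equal_letters: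
  fixes x :: "'a biseq"
  assumes c: "letter_coboundary A X c" and x: "x \<in> X" "range x \<subseteq> A"
    and ret: "x (i + int n) = x i"
  shows "(\<Sum>k<n. c [x (i + int k)]) = 0"
  using ret
proof (induction n arbitrary: i rule: less_induct)
  case (less n)
  show ?case
  proof (cases "n = 0")
    case False
    define m where "m = (LEAST m. 0 < m \<and> x (i + int m) = x i)"
    have m: "0 < m" "x (i + int m) = x i"
      using LeastI[of "\<lambda>m. 0 < m \<and> x (i + int m) = x i" n] False less.prems by (auto simp: m_def)
    have mn: "m \<le> n" unfolding m_def using False less.prems by (intro Least_le) auto
    have "return_word A X (x i) (map (\<lambda>k. x (i + int k)) [0..<m])"
      using x m not_less_Least[of _ "\<lambda>m. 0 < m \<and> x (i + int m) = x i"]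
      by (intro return_word_first_return) (auto simp: m_def)
    then have "c (map (\<lambda>k. x (i + int k)) [0..<m]) = 0"
      using c x(2) unfolding letter_coboundary_def by blast
    then have head: "(\<Sum>k<m. c [x (i + int k)]) = 0"
      using c x(2) by (subst (asm) word_morphism_eq_sum_letters[of A])
        (auto simp: letter_coboundary_def)
    have "x ((i + int m) + int (n - m)) = x (i + int m)"
      using less.prems m mn by simp
    from less.IH[OF _ this] have tail: "(\<Sum>k<n - m. c [x (i + int m + int k)]) = 0"
      using m False by simp
    have "(\<Sum>k<n. c [x (i + int k)])
        = (\<Sum>k<m. c [x (i + int k)]) + (\<Sum>k\<in>{m..<n}. c [x (i + int k)])"
      using mn by (metis atLeast0LessThan sum.atLeastLessThan_concat zero_le)
    also have "(\<Sum>k\<in>{m..<n}. c [x (i + int k)]) = (\<Sum>k<n - m. c [x (i + int m + int k)])"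
      using mn by (intro sum.reindex_bij_witness[of _ "\<lambda>k. k + m" "\<lambda>k. k - m"]) auto
    finally show ?thesis using head tail by simp
  qed simp
qed

lemma ex_int_primitive:
  fixes f :: "int \<Rightarrow> 'b::ab_group_add"
  shows "\<exists>S. \<forall>n. S (n + 1) - S n = f n"
proof (intro exI allI)
  fix n :: int
  \<comment> \<open>one of the two sums is always empty\<close>
  let ?S = "\<lambda>n. sum f {0..<n} - sum f {n..<0}"
  show "?S (n + 1) - ?S n = f n"
  proof (cases "0 \<le> n")
    case True
    then have "{0..<n + 1} = insert n {0..<n}" by auto
    with True show ?thesis by simp
  next
    case False
    then have "{n..<0} = insert n {n + 1..<0}" by auto
    with False show ?thesis by simp
  qed
qed

lemma letter_coboundary_potential_along_point:
  fixes x :: "'a biseq"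
  assumes c: "letter_coboundary A X c" and x: "x \<in> X" "range x \<subseteq> A"
  shows "\<exists>g. \<forall>n. c [x n] = g (x (n + 1)) - g (x n)"
proof -
  obtain S where S: "\<And>n. S (n + 1) - S n = c [x n]"
    using ex_int_primitive[of "\<lambda>n. c [x n]"] by blast
  have sum: "(\<Sum>k<m. c [x (i + int k)]) = S (i + int m) - S i" for i m
    by (induction m) (simp_all add: S[symmetric] algebra_simps)
  have le: "S i = S j" if "x i = x j" "i \<le> j" for i j
  proof -
    have "x (i + int (nat (j - i))) = x i" using that by simp
    from letter_coboundary_sum_between_equal_letters[OF c x this] show ?thesis
      using that by (simp add: sum)
  qed
  have eq: "S i = S j" if "x i = x j" for i j
    using le[OF that] le[OF that[symmetric]] linear[of i j] by metis
  define g where "g a = S (SOME n. x n = a)" for a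
  have "g (x n) = S n" for n
  proof -
    have "x (SOME k. x k = x n) = x n" by (rule someI[where x = n]) (rule refl)
    from eq[OF this] show ?thesis by (simp only: g_def)
  qed
  then have "\<forall>n. c [x n] = g (x (n + 1)) - g (x n)" by (simp add: S)
  then show ?thesis by (rule exI[of _ g])
qed

section \<open>Cylinders in subshifts\<close>

lemma subshift_subset_topspace:
  "subshift A X \<Longrightarrow> X \<subseteq> topspace (full_shift A)"
  by (simp add: subshift_def closedin_subset)

lemma subshift_range_subset:
  "subshift A X \<Longrightarrow> x \<in> X \<Longrightarrow> range x \<subseteq> A"
  using subshift_subset_topspace by (fastforce simp: full_shift_def PiE_iff)

lemma openin_subshift_letter:
  assumes "subshift A X"
  shows "openin (subtopology (full_shift A) X) {y \<in> X. y n = a}"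
proof (cases "a \<in> A")
  case True
  have "continuous_map (full_shift A) (discrete_topology A) (\<lambda>y. y n)"
    unfolding full_shift_def by (rule continuous_map_product_projection) simp
  from openin_continuous_map_preimage[OF this, of "{a}"] True
  have "openin (full_shift A) {y \<in> topspace (full_shift A). y n \<in> {a}}" by simp
  moreover have "{y \<in> X. y n = a} = {y \<in> topspace (full_shift A). y n \<in> {a}} \<inter> X"
    using subshift_subset_topspace[OF assms] by auto
  ultimately show ?thesis unfolding openin_subtopology by blast
next
  case False
  then have "{y \<in> X. y n = a} = {}" using subshift_range_subset[OF assms] by auto
  then show ?thesis by (simp only: openin_empty)
qed

lemma minimal_subshift_two_letter_word_occurs:
  assumes min: "minimal_subshift A X" and x: "x \<in> X" and y: "y \<in> X"
  shows "\<exists>n. x n = y 0 \<and> x (n + 1) = y 1"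
proof -
  let ?T = "subtopology (full_shift A) X"
  let ?U = "{z \<in> X. z 0 = y 0} \<inter> {z \<in> X. z 1 = y 1}"
  have "openin ?T ?U"
    using min by (intro openin_Int openin_subshift_letter) (auto simp: minimal_subshift_def)
  moreover have "y \<in> ?T closure_of orbit x" "y \<in> ?U"
    using min x y by (auto simp: minimal_subshift_def)
  ultimately have "\<exists>z. z \<in> orbit x \<and> z \<in> ?U"
    by (simp only: in_closure_of)
  then obtain z where z: "z \<in> orbit x" "z \<in> ?U" by (elim exE conjE)
  from z(1) obtain n where n: "z = (\<lambda>i. x (i + n))" unfolding orbit_def by blast
  have "z 0 = y 0" "z 1 = y 1" using z(2) by blast+
  then have "x n = y 0 \<and> x (n + 1) = y 1" unfolding n by (simp add: add.commute[of 1])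
  then show ?thesis by (rule exI)
qed

lemma letter_coboundary_potential:
  assumes min: "minimal_subshift A X" and c: "letter_coboundary A X c"
  shows "\<exists>g. \<forall>y\<in>X. c [y 0] = g (y 1) - g (y 0)"
proof (cases "X = {}")
  case False
  then obtain x where x: "x \<in> X" by blast
  moreover have "range x \<subseteq> A"
    using min x by (auto simp: minimal_subshift_def dest: subshift_range_subset)
  ultimately obtain g where "\<forall>n. c [x n] = g (x (n + 1)) - g (x n)"
    using letter_coboundary_potential_along_point[OF c] by blast
  then show ?thesis
    using minimal_subshift_two_letter_word_occurs[OF min x] by metis
qed simp

section \<open>Coboundaries and invariant measures\<close>

lemma (in finite_measure) integral_finite_fibres:
  fixes f :: "'b \<Rightarrow> real"
  assumes A: "finite A" and p: "\<And>y. y \<in> space M \<Longrightarrow> p y \<in> A"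
    and meas: "\<And>a. a \<in> A \<Longrightarrow> {y \<in> space M. p y = a} \<in> sets M"
  shows "integrable M (\<lambda>y. f (p y))"
    and "(\<integral>y. f (p y) \<partial>M) = (\<Sum>a\<in>A. f a * measure M {y \<in> space M. p y = a})"
proof -
  let ?F = "\<lambda>a. {y \<in> space M. p y = a}"
  have eq: "f (p y) = (\<Sum>a\<in>A. f a * indicator (?F a) y)" if "y \<in> space M" for y
  proof -
    have "(\<Sum>a\<in>A. f a * indicator (?F a) y) = (\<Sum>a\<in>A. if a = p y then f a else 0)"
      using that by (intro sum.cong) (auto simp: indicator_def)
    then show ?thesis using A p[OF that] by simp
  qed
  have int: "integrable M (\<lambda>y. f a * indicator (?F a) y)" if "a \<in> A" for a
    using meas[OF that] by (intro integrable_mult_right) (simp add: emeasure_eq_measure)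
  show "integrable M (\<lambda>y. f (p y))"
    using int by (subst Bochner_Integration.integrable_cong[OF refl eq]) auto
  have "(\<integral>y. f (p y) \<partial>M) = (\<integral>y. (\<Sum>a\<in>A. f a * indicator (?F a) y) \<partial>M)"
    by (rule Bochner_Integration.integral_cong[OF refl eq])
  also have "\<dots> = (\<Sum>a\<in>A. f a * measure M (?F a))"
    using int meas by (subst Bochner_Integration.integral_sum) (auto intro!: sum.cong)
  finally show "(\<integral>y. f (p y) \<partial>M) = (\<Sum>a\<in>A. f a * measure M {y \<in> space M. p y = a})" .
qed

text \<open>The two terms of the coboundary have the same integral, because the letters at positions
  \<open>0\<close> and \<open>1\<close> have the same distribution.\<close>

lemma invariant_measure_coboundary_sum_eq_0:
  fixes q h :: "'a \<Rightarrow> real"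
  assumes A: "finite A" and X: "subshift A X" and \<mu>: "\<mu> \<in> invariant_measures A X"
    and cob: "\<And>y. y \<in> X \<Longrightarrow> q (y 0) = h (y 1) - h (y 0)"
  shows "(\<Sum>a\<in>A. q a * measure \<mu> (cylinder X a)) = 0"
proof -
  interpret prob_space \<mu> using \<mu> by (simp add: invariant_measures_def)
  have sp: "space \<mu> = X" using \<mu> by (simp add: invariant_measures_def)
  have meas: "{y \<in> space \<mu>. y n = a} \<in> sets \<mu>" for n a
  proof -
    let ?T = "subtopology (full_shift A) X"
    have "{y \<in> X. y n = a} \<in> sets (borel_on ?T)"
      unfolding borel_on_def
      by (rule in_measure_of) (use openin_subshift_letter[OF X] openin_subset in blast)+
    then show ?thesis using \<mu> sp by (simp add: invariant_measures_def)
  qed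
  have let_A: "y n \<in> A" if "y \<in> space \<mu>" for y n
    using subshift_range_subset[OF X] that sp by blast
  have int: "integrable \<mu> (\<lambda>y. f (y n))"
    "(\<integral>y. f (y n) \<partial>\<mu>) = (\<Sum>a\<in>A. f a * measure \<mu> {y \<in> space \<mu>. y n = a})"
    for f :: "'a \<Rightarrow> real" and n
    using integral_finite_fibres[OF A, of "\<lambda>y. y n" f] let_A meas by auto
  have inv: "measure \<mu> {y \<in> space \<mu>. y 1 = a} = measure \<mu> {y \<in> space \<mu>. y 0 = a}" for a
  proof -
    have "shift y \<in> X" if "y \<in> X" for y using X that by (auto simp: subshift_def)
    then have eq: "shift -` {y \<in> space \<mu>. y 0 = a} \<inter> X = {y \<in> space \<mu>. y 1 = a}"
      by (auto simp: sp shift_def)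
    have "\<forall>B\<in>sets \<mu>. measure \<mu> (shift -` B \<inter> X) = measure \<mu> B"
      using \<mu> by (simp add: invariant_measures_def)
    from bspec[OF this meas[of 0 a]] show ?thesis by (simp only: eq)
  qed
  have "(\<Sum>a\<in>A. q a * measure \<mu> (cylinder X a)) = (\<integral>y. q (y 0) \<partial>\<mu>)"
    by (simp only: int(2) cylinder_def sp)
  also have "\<dots> = (\<integral>y. h (y 1) - h (y 0) \<partial>\<mu>)"
    by (intro Bochner_Integration.integral_cong) (auto simp: sp cob)
  also have "\<dots> = (\<integral>y. h (y 1) \<partial>\<mu>) - (\<integral>y. h (y 0) \<partial>\<mu>)"
    by (intro Bochner_Integration.integral_diff int(1))
  also have "\<dots> = 0" by (simp add: int(2) inv)
  finally show ?thesis .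
qed

section \<open>From real to rational coefficients\<close>

text \<open>Extend \<open>t\<close> to a basis of the reals over the rationals and take the coordinate at \<open>t\<close>.\<close>

lemma ex_additive_real_to_rat:
  fixes t :: real
  assumes "t \<noteq> 0"
  shows "\<exists>\<phi> :: real \<Rightarrow> rat. (\<forall>u v. \<phi> (u - v) = \<phi> u - \<phi> v) \<and> \<phi> t \<noteq> 0"
proof -
  define B where "B = rat_real.extend_basis {t}"
  have ind: "rat_real.independent {t}"
    using assms by (simp add: rat_real.dependent_single)
  then have B: "rat_real.independent B" "rat_real.span B = UNIV" "t \<in> B"
    using rat_real.independent_extend_basis rat_real.span_extend_basis
      rat_real.extend_basis_superset unfolding B_def by blast+
  let ?\<phi> = "\<lambda>u. rat_real.representation B u t"
  have "?\<phi> (u - v) = ?\<phi> u - ?\<phi> v" for u v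
    using rat_real.representation_diff[OF B(1), of v u] B(2) by simp
  moreover have "?\<phi> t \<noteq> 0"
    using rat_real.representation_basis[OF B(1,3)] by simp
  ultimately show ?thesis by (intro exI[of _ ?\<phi>]) simp
qed

theorem proposition6p11:
  fixes A :: "'a set" and X :: "(int \<Rightarrow> 'a) set"
  assumes "finite A"
    and "minimal_subshift A X"
    and "\<exists>\<mu>\<in>invariant_measures A X.
           rat_independent_family A (\<lambda>a. measure \<mu> (cylinder X a))"
  shows "\<forall>c. letter_coboundary A X c \<longrightarrow> trivial_coboundary A c"
proof (intro allI impI)
  fix c assume c: "letter_coboundary A X c"
  obtain \<mu> where \<mu>: "\<mu> \<in> invariant_measures A X"
    and ind: "rat_independent_family A (\<lambda>a. measure \<mu> (cylinder X a))"
    using assms(3) by blast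
  have X: "subshift A X" using assms(2) by (simp add: minimal_subshift_def)
  obtain g where g: "\<And>y. y \<in> X \<Longrightarrow> c [y 0] = g (y 1) - g (y 0)"
    using letter_coboundary_potential[OF assms(2) c] by blast
  have "c [a] = 0" if a: "a \<in> A" for a
  proof (rule ccontr)
    assume "c [a] \<noteq> 0"
    then obtain \<phi> :: "real \<Rightarrow> rat"
      where diff: "\<And>u v. \<phi> (u - v) = \<phi> u - \<phi> v" and nz: "\<phi> (c [a]) \<noteq> 0"
      using ex_additive_real_to_rat by metis
    have "(\<Sum>b\<in>A. of_rat (\<phi> (c [b])) * measure \<mu> (cylinder X b)) = 0"
      by (rule invariant_measure_coboundary_sum_eq_0[OF assms(1) X \<mu>,
            where h = "\<lambda>b. of_rat (\<phi> (g b))"])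
        (simp add: g diff of_rat_diff)
    then have "\<phi> (c [a]) = 0"
      using ind a unfolding rat_independent_family_def by (auto dest!: spec[of _ "\<lambda>b. \<phi> (c [b])"])
    with nz show False by contradiction
  qed
  then show "trivial_coboundary A c" by (simp add: trivial_coboundary_def)
qed

end
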